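(* Let $\Omega\subset\mathbb{R}^n$ be open, $A\in L^\infty(\Omega\to\mathbb{C}^{n\times n})$ and $p\in(0,\infty)$. Then $$ \Delta_p(A)=\frac{2}{p^2}\,\operatorname*{ess\,inf}_{x\in\Omega}\ \min_{\xi\in\mathbb{C}^n,|\xi|=1}\ \min_{\zeta\in\mathbb{C},|\zeta|=1}H_{F_p}^{A(x)}[\zeta;\xi]. $$ If $p\geq1$ then also $\Delta_p(A)=\Delta_q(A)$, where $q=p/(p-1)$ if $p\neq1$ and $q=\infty$ if $p=1$.
   Context: $\langle z,w\rangle=\sum_jz_j\overline{w_j}$ on $\mathbb{C}^n$. For $p\in(0,\infty]$, $\mathcal{I}_p\xi=\xi+(1-2/p)\bar\xi$ for $\xi\in\mathbb{C}^n$ (with $2/\infty=0$), and for bounded measurable $A:\Omega\to\mathbb{C}^{n\times n}$, $\Delta_p(A)=\operatorname{ess\,inf}_{x\in\Omega}\min_{|\xi|=1}\mathrm{Re}\langle A(x)\xi,\mathcal{I}_p\xi\rangle$. $F_p:\mathbb{C}\to[0,\infty)$, $F_p(\zeta)=|\zeta|^p$. For $A\in\mathbb{C}^{n\times n}$, $F:\mathbb{C}\to\mathbb{R}$ twice differentiable at $\zeta\in\mathbb{C}$ and $\xi\in\mathbb{C}^n$, $$H_F^A[\zeta;\xi]=\big\langle[\mathrm{Hess}(F;\zeta)\otimes I_{\mathbb{R}^n}]\,\mathcal{V}(\xi),\mathcal{M}(A)\mathcal{V}(\xi)\big\rangle_{\mathbb{R}^{2n}},$$ where $\mathrm{Hess}(F;\zeta)$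 is the real $2\times2$ Hessian of $F$ at $\zeta$ in the variables $(\mathrm{Re}\,\zeta,\mathrm{Im}\,\zeta)$, $\otimes$ is the Kronecker product ($[d_{ij}]\otimes I_{\mathbb{R}^n}=[d_{ij}I_n]$), $\mathcal{V}(\xi)=(\mathrm{Re}\,\xi,\mathrm{Im}\,\xi)\in\mathbb{R}^{2n}$ and $\mathcal{M}(A)=\begin{bmatrix}\mathrm{Re}A&-\mathrm{Im}A\\ \mathrm{Im}A&\mathrm{Re}A\end{bmatrix}$ (entrywise real and imaginary parts). *)

theory Defs
  imports "HOL-Analysis.Analysis"
begin

(* A representative of an element of L^infinity(Om -> C^{n x n}). *)
definition Linfty_on :: "(real^'n) set \<Rightarrow> (real^'n \<Rightarrow> complex^'n^'n) \<Rightarrow> bool" where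
  "Linfty_on Om A \<longleftrightarrow> A \<in> borel_measurable (lebesgue_on Om) \<and>
     (\<exists>C. AE x in lebesgue_on Om. norm (A x) \<le> C)"

(* Extended-real valued; over a null space (in particular for empty Om) it is \<infinity>. *)
definition ess_inf :: "'a measure \<Rightarrow> ('a \<Rightarrow> ereal) \<Rightarrow> ereal" where
  "ess_inf M f = Sup {c. AE x in M. c \<le> f x}"

(* A true minimum; it is only meaningful when f attains its infimum on S, for instance
   in the situation of minimum_on_attained below. *)
definition minimum_on :: "'a set \<Rightarrow> ('a \<Rightarrow> real) \<Rightarrow> real" where
  "minimum_on S f = (LEAST m. m \<in> f ` S)"

lemma minimum_on_eqI:
  assumes "x \<in> S" "\<And>y. y \<in> S \<Longrightarrow> f x \<le> f y"
  shows "minimum_on S f = f x"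
  unfolding minimum_on_def by (rule Least_equality) (use assms in auto)

lemma minimum_on_attained:
  fixes f :: "'a::topological_space \<Rightarrow> real"
  assumes "compact S" "S \<noteq> {}" "continuous_on S f"
  shows "\<exists>x\<in>S. minimum_on S f = f x \<and> (\<forall>y\<in>S. f x \<le> f y)"
  using continuous_attains_inf[OF assms] minimum_on_eqI by metis

definition cinner :: "complex^'n \<Rightarrow> complex^'n \<Rightarrow> complex" where
  "cinner z w = (\<Sum>j\<in>UNIV. z $ j * cnj (w $ j))"

definition cnj_vec :: "complex^'n \<Rightarrow> complex^'n" where
  "cnj_vec \<xi> = (\<chi> j. cnj (\<xi> $ j))"

(* The exponent ranges over (0,\<infinity>]; the quotient is taken in ereal, where 2 / \<infinity> = 0. *)
definition I_op :: "ereal \<Rightarrow> complex^'n \<Rightarrow> complex^'n" where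
  "I_op p \<xi> = \<xi> + (1 - real_of_ereal (2 / p)) *\<^sub>R cnj_vec \<xi>"

definition Delta :: "ereal \<Rightarrow> (real^'n) set \<Rightarrow> (real^'n \<Rightarrow> complex^'n^'n) \<Rightarrow> ereal" where
  "Delta p Om A = ess_inf (lebesgue_on Om)
     (\<lambda>x. ereal (minimum_on {\<xi>. norm \<xi> = 1} (\<lambda>\<xi>. Re (cinner (A x *v \<xi>) (I_op p \<xi>)))))"

definition F_pow :: "real \<Rightarrow> complex \<Rightarrow> real" where
  "F_pow p \<zeta> = cmod \<zeta> powr p"

(* C identified with R^2: index 1 is the real and index 2 the imaginary direction. *)
definition e_dir :: "2 \<Rightarrow> complex" where
  "e_dir i = (if i = 1 then 1 else \<i>)"

definition Hess :: "(complex \<Rightarrow> real) \<Rightarrow> complex \<Rightarrow> real^2^2" where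
  "Hess F \<zeta> = (\<chi> i j. frechet_derivative (\<lambda>z. frechet_derivative F (at z) (e_dir j)) (at \<zeta>) (e_dir i))"

(* With index pairs read lexicographically, kron D (mat 1) is the block matrix [d_ij I_n]. *)
definition kron :: "real^'b^'a \<Rightarrow> real^'d^'c \<Rightarrow> real^('b \<times> 'd)^('a \<times> 'c)" where
  "kron D E = (\<chi> r s. D $ fst r $ fst s * E $ snd r $ snd s)"

(* R^{2n} is real^(2 \<times> 'n): (1,j) indexes the upper and (2,j) the lower block. *)
definition V_vec :: "complex^'n \<Rightarrow> real^(2 \<times> 'n)" where
  "V_vec \<xi> = (\<chi> r. if fst r = 1 then Re (\<xi> $ snd r) else Im (\<xi> $ snd r))"

definition M_mat :: "complex^'n^'n \<Rightarrow> real^(2 \<times> 'n)^(2 \<times> 'n)" where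
  "M_mat A = (\<chi> r s. let a = A $ snd r $ snd s in
     if fst r = fst s then Re a else if fst r = 1 then - Im a else Im a)"

definition H_form :: "(complex \<Rightarrow> real) \<Rightarrow> complex^'n^'n \<Rightarrow> complex \<Rightarrow> complex^'n \<Rightarrow> real" where
  "H_form F A \<zeta> \<xi> = (kron (Hess F \<zeta>) (mat 1 :: real^'n^'n) *v V_vec \<xi>) \<bullet> (M_mat A *v V_vec \<xi>)"

end

theory Submission
  imports Defs
begin

text \<open>
  On the unit circle the Hessian of \<open>F_pow p\<close> is \<open>p (I + (p - 2) \<zeta> \<zeta>\<^sup>T)\<close>, and the real projection
  onto \<open>\<zeta>\<close> is \<open>w \<mapsto> (w + \<zeta>\<^sup>2 cnj w) / 2\<close>. Hence the form \<open>H\<close> at \<open>(\<zeta>, \<xi>)\<close> equals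
  \<open>p\<^sup>2 / 2\<close> times \<open>Re \<langle>A \<eta>, I\<^sub>p \<eta>\<rangle>\<close> at the rotated vector \<open>\<eta> = cnj \<zeta> \<xi>\<close>, so both minima agree up to
  this factor. Passing from \<open>p\<close> to its conjugate exponent changes the sign of \<open>1 - 2 / p\<close>,
  which is undone by the rotation \<open>\<xi> \<mapsto> \<i> \<xi>\<close>.
\<close>

section \<open>Scaling and invariance of minima and essential infima\<close>

lemma minimum_on_cmult:
  fixes f :: "'a::topological_space \<Rightarrow> real"
  assumes "compact S" "S \<noteq> {}" "continuous_on S f" "0 \<le> c"
  shows "minimum_on S (\<lambda>x. c * f x) = c * minimum_on S f"
proof -
  obtain x where x: "x \<in> S" "minimum_on S f = f x" "\<forall>y\<in>S. f x \<le> f y"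
    using minimum_on_attained[OF assms(1-3)] by blast
  show ?thesis
    unfolding x(2) by (rule minimum_on_eqI) (use x assms(4) in \<open>auto intro: mult_left_mono\<close>)
qed

lemma minimum_on_compose:
  assumes "h ` S = S"
  shows "minimum_on S (\<lambda>x. f (h x)) = minimum_on S f"
proof -
  have "(\<lambda>x. f (h x)) ` S = f ` S"
    using assms by (metis image_image)
  then show ?thesis
    by (simp add: minimum_on_def)
qed

text \<open>Multiplication by \<open>c > 0\<close> is an order automorphism of the extended reals,
  so it carries the essential lower bounds of \<open>f\<close> onto those of \<open>c * f\<close>
  and commutes with \<open>Sup\<close>.\<close>

lemma ess_inf_cmult:
  assumes "0 < c"
  shows "ess_inf M (\<lambda>x. ereal (c * f x)) = ereal c * ess_inf M (\<lambda>x. ereal (f x))"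
proof -
  have div: "ereal c * (b / ereal c) = b" "b / ereal c \<le> ereal y \<longleftrightarrow> b \<le> ereal (c * y)" for b y
    using assms by (cases b; simp add: field_simps)+
  have mult: "ereal c * a \<le> ereal (c * y) \<longleftrightarrow> a \<le> ereal y" for a y
    using assms by (cases a; simp)
  have "{b. AE x in M. b \<le> ereal (c * f x)} = (\<lambda>a. ereal c * a) ` {a. AE x in M. a \<le> ereal (f x)}"
    (is "?L = ?R")
  proof
    show "?L \<subseteq> ?R"
    proof
      fix b assume "b \<in> ?L"
      then have "b / ereal c \<in> {a. AE x in M. a \<le> ereal (f x)}"
        by (simp add: div)
      then show "b \<in> ?R"
        by (metis div(1) image_eqI)
    qed
    show "?R \<subseteq> ?L"
      by (auto simp: mult)
  qed
  moreover have "Sup ((\<lambda>a. ereal c * a) ` X) = ereal c * Sup X" if "X \<noteq> {}" for X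
    using Sup_ereal_mult_left'[of X c "\<lambda>x. x"] that assms by simp
  \<comment> \<open>The supremum rule asks for a nonempty set; the trivial lower bound supplies an
    element.\<close>
  moreover have "- \<infinity> \<in> {a. AE x in M. a \<le> ereal (f x)}"
    by simp
  ultimately show ?thesis
    unfolding ess_inf_def by (metis empty_iff)
qed

section \<open>First and second derivatives of the power function\<close>

lemma has_derivative_F_pow:
  assumes "z \<noteq> 0"
  shows "(F_pow p has_derivative (\<lambda>h. p * cmod z powr (p - 2) * (z \<bullet> h))) (at z)"
proof -
  have "((\<lambda>z. cmod z powr p) has_derivative (\<lambda>h. p * cmod z powr (p - 2) * (z \<bullet> h))) (at z)"
    using assms
    by (auto intro!: derivative_eq_intros has_derivative_norm
        simp: fun_eq_iff sgn_div_norm inner_commute powr_diff field_simps power2_eq_square)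
  then show ?thesis
    by (simp add: F_pow_def[abs_def])
qed

lemma Hess_F_pow:
  assumes "cmod \<zeta> = 1"
  shows "Hess (F_pow p) \<zeta> $ i $ j =
    p * (e_dir i \<bullet> e_dir j + (p - 2) * (\<zeta> \<bullet> e_dir i) * (\<zeta> \<bullet> e_dir j))"
proof -
  have nz: "\<zeta> \<noteq> 0"
    using assms by auto
  have 1: "frechet_derivative (F_pow p) (at z) h = p * F_pow (p - 2) z * (z \<bullet> h)" if "z \<noteq> 0" for z h
    using frechet_derivative_at[OF has_derivative_F_pow[OF that, of p]] by (metis F_pow_def)
  have "((\<lambda>z. p * F_pow (p - 2) z * (z \<bullet> e_dir j)) has_derivative
     (\<lambda>h. p * (h \<bullet> e_dir j + (p - 2) * (\<zeta> \<bullet> h) * (\<zeta> \<bullet> e_dir j)))) (at \<zeta>)"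
    using nz assms
    by (auto intro!: derivative_eq_intros has_derivative_norm
        simp: F_pow_def[abs_def] sgn_div_norm inner_commute algebra_simps)
  then have "((\<lambda>z. frechet_derivative (F_pow p) (at z) (e_dir j)) has_derivative
     (\<lambda>h. p * (h \<bullet> e_dir j + (p - 2) * (\<zeta> \<bullet> h) * (\<zeta> \<bullet> e_dir j)))) (at \<zeta>)"
    \<comment> \<open>The gradient formula is known only away from the origin, hence the passage
      through the open set \<open>- {0}\<close> around \<zeta>.\<close>
    by (rule has_derivative_transform_within_open[where s = "- {0}"]) (use nz 1 in auto)
  then show ?thesis
    by (simp add: Hess_def frechet_derivative_at[symmetric])
qed

section \<open>Real block matrices as operations on complex vectors\<close>

lemma sum_UNIV_2_times:
  "(\<Sum>r\<in>(UNIV :: (2 \<times> 'n::finite) set). f r) = (\<Sum>k\<in>UNIV. f (1, k) + f (2, k))"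
proof -
  have "(\<Sum>r\<in>UNIV. f r) = (\<Sum>i\<in>(UNIV::2 set). \<Sum>k\<in>UNIV. f (i, k))"
    by (simp add: sum.cartesian_product)
  then show ?thesis
    by (simp add: sum_2 sum.distrib)
qed

lemma inner_V_vec: "V_vec \<xi> \<bullet> V_vec \<eta> = Re (cinner \<xi> \<eta>)"
  by (simp add: inner_vec_def V_vec_def cinner_def sum_UNIV_2_times)

lemma M_mat_V_vec: "M_mat A *v V_vec \<xi> = V_vec (A *v \<xi>)"
proof -
  have "(M_mat A *v V_vec \<xi>) $ (i, j) = V_vec (A *v \<xi>) $ (i, j)" for i j
    using exhaust_2[of i]
    by (auto simp: matrix_vector_mult_def V_vec_def M_mat_def sum_UNIV_2_times Let_def algebra_simps)
  then show ?thesis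
    by (simp add: vec_eq_iff)
qed

lemma V_vec_nth: "V_vec \<xi> $ (i, j) = (if i = 1 then Re (\<xi> $ j) else Im (\<xi> $ j))"
  by (simp add: V_vec_def)

lemma kron_mat_1_V_vec:
  "(kron D (mat 1 :: real^'n^'n) *v V_vec \<xi>) $ (i, j) =
    D $ i $ 1 * Re (\<xi> $ j) + D $ i $ 2 * Im (\<xi> $ j)"
  by (simp add: matrix_vector_mult_def V_vec_def kron_def sum_UNIV_2_times mat_def
      if_distrib[where f = "\<lambda>x. _ * x"] if_distrib[where f = "\<lambda>x. x * _"] sum.distrib cong: if_cong)

lemma kron_Hess_F_pow_V_vec:
  fixes \<xi> :: "complex^'n"
  assumes "cmod \<zeta> = 1" "p \<noteq> 0"
  shows "kron (Hess (F_pow p) \<zeta>) (mat 1 :: real^'n^'n) *v V_vec \<xi> =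
    V_vec ((p\<^sup>2 / 2) *\<^sub>R (\<xi> + (1 - 2 / p) *\<^sub>R (\<zeta>\<^sup>2 *s cnj_vec \<xi>)))" (is "?L = ?R")
proof -
  define a b where "a = Re \<zeta>" and "b = Im \<zeta>"
  have sq: "a\<^sup>2 + b\<^sup>2 = 1"
    using assms(1) cmod_power2[of \<zeta>] by (simp add: a_def b_def)
  \<comment> \<open>Clears the denominator in \<open>1 - 2 / p\<close>; this is where
    \<open>p \<noteq> 0\<close> enters.\<close>
  have p: "p * p / 2 * (x + (1 - 2 / p) * y) = p / 2 * (p * x + (p - 2) * y)" for x y
    using assms(2) by (simp add: field_simps)
  \<comment> \<open>The two rows of the Hessian applied to w = x + iy: with
    \<open>\<zeta>\<^sup>2\<close> = (a^2 - b^2) + 2abi, the inner brackets are the real and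
    imaginary parts of \<open>\<zeta>\<^sup>2 * cnj w\<close>.\<close>
  have 1: "p * (1 + (p - 2) * a * a) * x + p * ((p - 2) * a * b) * y
      = p / 2 * (p * x + (p - 2) * ((a\<^sup>2 - b\<^sup>2) * x + 2 * (b * a) * y))" for x y
    using sq by algebra
  have 2: "p * ((p - 2) * b * a) * x + p * (1 + (p - 2) * b * b) * y
      = p / 2 * (p * y + (p - 2) * (2 * (b * a) * x - (a\<^sup>2 - b\<^sup>2) * y))" for x y
    using sq by algebra
  have "?L $ (i, j) = ?R $ (i, j)" for i j
    using exhaust_2[of i] assms(1) 1[of "Re (\<xi> $ j)" "Im (\<xi> $ j)"] 2[of "Re (\<xi> $ j)" "Im (\<xi> $ j)"]
    by (auto simp: kron_mat_1_V_vec V_vec_nth Hess_F_pow e_dir_def cnj_vec_def inner_complex_def p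
        a_def b_def power2_eq_square simp del: times_divide_eq_left)
  then show ?thesis
    by (simp add: vec_eq_iff)
qed

section \<open>The form in \<open>Delta\<close> and its behaviour under rotations\<close>

text \<open>At \<open>s = 1 - 2 / p\<close> this is the form minimised in \<open>Delta p\<close>. A
  free real \<open>s\<close> turns conjugation of exponents into a change of sign.\<close>

definition twisted_form :: "complex^'n^'n \<Rightarrow> real \<Rightarrow> complex^'n \<Rightarrow> real" where
  "twisted_form A s \<xi> = Re (cinner (A *v \<xi>) (\<xi> + s *\<^sub>R cnj_vec \<xi>))"

lemma continuous_on_twisted_form: "continuous_on S (twisted_form A s)"
  unfolding twisted_form_def[abs_def] cinner_def cnj_vec_def matrix_vector_mult_def
  by (simp, intro continuous_intros)

text \<open>By complex linearity \<open>cnj \<zeta>\<close> leaves the first slot and enters the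
  second as \<zeta>. There it cancels against \<open>cnj \<zeta>\<close> on \<xi> and doubles to
  \<open>\<zeta>\<^sup>2\<close> on the conjugate of \<xi>.\<close>

lemma twisted_form_rotate:
  assumes "cmod \<zeta> = 1"
  shows "twisted_form A s (cnj \<zeta> *s \<xi>) = Re (cinner (A *v \<xi>) (\<xi> + s *\<^sub>R (\<zeta>\<^sup>2 *s cnj_vec \<xi>)))"
proof -
  have *: "cnj \<zeta> * \<zeta> = 1"
    using assms by (metis complex_norm_square mult.commute of_real_1 power_one)
  have "cinner (A *v (cnj \<zeta> *s \<xi>)) (cnj \<zeta> *s \<xi> + s *\<^sub>R cnj_vec (cnj \<zeta> *s \<xi>))
      = cinner (A *v \<xi>) (\<xi> + s *\<^sub>R (\<zeta>\<^sup>2 *s cnj_vec \<xi>))"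
    unfolding cinner_def
  proof (rule sum.cong)
    fix j
    have "(A *v (cnj \<zeta> *s \<xi>)) $ j = cnj \<zeta> * (A *v \<xi>) $ j"
      by (simp add: vector_scalar_commute)
    moreover have "cnj \<zeta> * cnj ((cnj \<zeta> *s \<xi> + s *\<^sub>R cnj_vec (cnj \<zeta> *s \<xi>)) $ j)
        = cnj ((\<xi> + s *\<^sub>R (\<zeta>\<^sup>2 *s cnj_vec \<xi>)) $ j)"
      using * by (simp add: cnj_vec_def algebra_simps power2_eq_square scaleR_conv_of_real)
    ultimately show "(A *v (cnj \<zeta> *s \<xi>)) $ j * cnj ((cnj \<zeta> *s \<xi> + s *\<^sub>R cnj_vec (cnj \<zeta> *s \<xi>)) $ j)
       = (A *v \<xi>) $ j * cnj ((\<xi> + s *\<^sub>R (\<zeta>\<^sup>2 *s cnj_vec \<xi>)) $ j)"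
      by (metis mult.assoc mult.commute)
  qed simp
  then show ?thesis
    by (simp add: twisted_form_def)
qed

lemma H_form_F_pow:
  assumes "cmod \<zeta> = 1" "p \<noteq> 0"
  shows "H_form (F_pow p) A \<zeta> \<xi> = p\<^sup>2 / 2 * twisted_form A (1 - 2 / p) (cnj \<zeta> *s \<xi>)"
proof -
  have "Re (cinner (c *\<^sub>R \<eta>) \<theta>) = c * Re (cinner \<eta> \<theta>)" for c and \<eta> \<theta> :: "complex^'a"
    by (simp add: cinner_def sum_distrib_left mult.assoc)
  \<comment> \<open>\<open>H_form\<close> has the Hessian in the first slot and \<open>A\<close> in
    the second, the reverse of \<open>twisted_form\<close>; symmetry of the real part swaps
    them.\<close>
  moreover have "Re (cinner \<eta> \<theta>) = Re (cinner \<theta> \<eta>)" for \<eta> \<theta> :: "complex^'a"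
    by (metis inner_V_vec inner_commute)
  ultimately show ?thesis
    by (simp only: H_form_def kron_Hess_F_pow_V_vec[OF assms] M_mat_V_vec inner_V_vec
        twisted_form_rotate[OF assms(1)])
qed

section \<open>Minima over the unit sphere\<close>

lemma norm_scalar_mult_vec: "norm (c *s \<xi>) = cmod c * norm \<xi>" for \<xi> :: "complex^'n"
  by (simp add: norm_vec_def norm_mult L2_set_right_distrib)

lemma image_scalar_mult_sphere:
  assumes "cmod c = 1"
  shows "(\<lambda>\<xi>. c *s \<xi>) ` {\<xi> :: complex^'n. norm \<xi> = 1} = {\<xi>. norm \<xi> = 1}"
proof -
  have "\<xi> \<in> (\<lambda>\<xi>. c *s \<xi>) ` {\<xi>. norm \<xi> = 1}" if "norm \<xi> = 1" for \<xi> :: "complex^'n"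
  proof
    show "\<xi> = c *s (inverse c *s \<xi>)"
      using assms by (cases "c = 0") (simp_all add: vec_eq_iff)
    show "inverse c *s \<xi> \<in> {\<xi>. norm \<xi> = 1}"
      using assms that by (simp add: norm_scalar_mult_vec norm_inverse)
  qed
  then show ?thesis
    using assms by (auto simp: norm_scalar_mult_vec)
qed

lemma compact_unit_sphere: "compact {\<xi> :: 'a::euclidean_space. norm \<xi> = 1}"
  and unit_sphere_nonempty: "{\<xi> :: 'a::euclidean_space. norm \<xi> = 1} \<noteq> {}"
proof -
  have *: "{\<xi> :: 'a. norm \<xi> = 1} = sphere 0 1"
    by (auto simp: sphere_def)
  show "compact {\<xi> :: 'a. norm \<xi> = 1}" "{\<xi> :: 'a. norm \<xi> = 1} \<noteq> {}"
    unfolding * by auto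
qed

lemma minimum_on_twisted_form_uminus:
  "minimum_on {\<xi>. norm \<xi> = 1} (twisted_form A (- s)) = minimum_on {\<xi>. norm \<xi> = 1} (twisted_form A s)"
proof -
  \<comment> \<open>Rotation with \<zeta> = \<i>: the vector is multiplied by
    \<open>cnj \<i> = - \<i>\<close>, and \<open>\<i>\<^sup>2 = - 1\<close> flips the sign of
    \<open>s\<close>.\<close>
  have "twisted_form A s (- \<i> *s \<xi>) = twisted_form A (- s) \<xi>" for \<xi>
    using twisted_form_rotate[of \<i> A s \<xi>] by (simp add: twisted_form_def)
  then show ?thesis
    using minimum_on_compose[OF image_scalar_mult_sphere, of "- \<i>" "twisted_form A s"] by simp
qed

text \<open>Rotations keep the sphere, so no rotated value falls below the global minimum, and at a
  global minimiser \<zeta> = 1 already reaches it.\<close>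

lemma minimum_on_rotations:
  fixes f :: "complex^'n \<Rightarrow> real"
  assumes f: "continuous_on {\<xi>. norm \<xi> = 1} f"
  shows "minimum_on {\<xi>. norm \<xi> = 1} (\<lambda>\<xi>. minimum_on {\<zeta>. cmod \<zeta> = 1} (\<lambda>\<zeta>. f (cnj \<zeta> *s \<xi>)))
    = minimum_on {\<xi>. norm \<xi> = 1} f"
    (is "minimum_on ?S ?m = _")
proof -
  obtain \<eta> where \<eta>: "\<eta> \<in> ?S" "minimum_on ?S f = f \<eta>" "\<And>\<xi>. \<xi> \<in> ?S \<Longrightarrow> f \<eta> \<le> f \<xi>"
    using minimum_on_attained[OF compact_unit_sphere unit_sphere_nonempty f] by blast
  have rot: "cnj \<zeta> *s \<xi> \<in> ?S" if "\<xi> \<in> ?S" "cmod \<zeta> = 1" for \<zeta> and \<xi> :: "complex^'n"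
    using that by (simp add: norm_scalar_mult_vec)
  have "?m \<eta> = f (cnj 1 *s \<eta>)"
    by (rule minimum_on_eqI) (use \<eta> rot in auto)
  then have m\<eta>: "?m \<eta> = f \<eta>"
    by simp
  have "?m \<eta> \<le> ?m \<xi>" if \<xi>: "\<xi> \<in> ?S" for \<xi>
  proof -
    \<comment> \<open>Continuity on the compact circle makes the inner minimum an actual value of
      \<open>f\<close> on the sphere, hence comparable with \<open>f \<eta>\<close>.\<close>
    have "continuous_on {\<zeta>. cmod \<zeta> = 1} (\<lambda>\<zeta>. cnj \<zeta> *s \<xi>)"
      unfolding vector_scalar_mult_def by (intro continuous_intros)
    then have "continuous_on {\<zeta>. cmod \<zeta> = 1} (\<lambda>\<zeta>. f (cnj \<zeta> *s \<xi>))"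
      by (rule continuous_on_compose2[OF f]) (use rot \<xi> in auto)
    then obtain \<zeta> where "cmod \<zeta> = 1" "?m \<xi> = f (cnj \<zeta> *s \<xi>)"
      using minimum_on_attained[OF compact_unit_sphere unit_sphere_nonempty] by blast
    then show ?thesis
      using \<eta>(3) rot \<xi> m\<eta> by simp
  qed
  with \<eta>(1) have "minimum_on ?S ?m = ?m \<eta>"
    by (rule minimum_on_eqI)
  then show ?thesis
    by (simp only: m\<eta> \<eta>(2))
qed

lemma minimum_on_H_form_F_pow:
  fixes A :: "complex^'n^'n"
  assumes "p \<noteq> 0"
  shows "minimum_on {\<xi>. norm \<xi> = 1} (\<lambda>\<xi>. minimum_on {\<zeta>. cmod \<zeta> = 1} (\<lambda>\<zeta>. H_form (F_pow p) A \<zeta> \<xi>))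
    = p\<^sup>2 / 2 * minimum_on {\<xi>. norm \<xi> = 1} (twisted_form A (1 - 2 / p))"
proof -
  have "minimum_on {\<zeta>. cmod \<zeta> = 1} (\<lambda>\<zeta>. H_form (F_pow p) A \<zeta> \<xi>) =
      minimum_on {\<zeta>. cmod \<zeta> = 1} (\<lambda>\<zeta>. p\<^sup>2 / 2 * twisted_form A (1 - 2 / p) (cnj \<zeta> *s \<xi>))" for \<xi>
    \<comment> \<open>The formula for \<open>H_form\<close> holds only on the circle, so the images
      of the circle are compared rather than the functions.\<close>
    using H_form_F_pow[OF _ assms] unfolding minimum_on_def
    by (intro arg_cong[where f = "\<lambda>X. LEAST m. m \<in> X"] image_cong) auto
  moreover have "continuous_on {\<xi>. norm \<xi> = 1} (\<lambda>\<xi>. p\<^sup>2 / 2 * twisted_form A (1 - 2 / p) \<xi>)"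
    by (intro continuous_intros continuous_on_twisted_form)
  note minimum_on_rotations[OF this]
  moreover have "minimum_on {\<xi>. norm \<xi> = 1} (\<lambda>\<xi>. p\<^sup>2 / 2 * twisted_form A (1 - 2 / p) \<xi>)
      = p\<^sup>2 / 2 * minimum_on {\<xi>. norm \<xi> = 1} (twisted_form A (1 - 2 / p))"
    by (rule minimum_on_cmult[OF compact_unit_sphere unit_sphere_nonempty continuous_on_twisted_form]) simp
  ultimately show ?thesis
    by (simp only:)
qed

lemma Delta_eq_twisted_form:
  "Delta p Om A = ess_inf (lebesgue_on Om)
     (\<lambda>x. ereal (minimum_on {\<xi>. norm \<xi> = 1} (twisted_form (A x) (1 - real_of_ereal (2 / p)))))"
  unfolding Delta_def I_op_def twisted_form_def[abs_def] ..

theorem proposition5p8: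
  fixes Om :: "(real^'n) set" and A :: "real^'n \<Rightarrow> complex^'n^'n" and p :: real
  assumes "open Om" and "Linfty_on Om A" and "0 < p"
  shows "Delta (ereal p) Om A = ereal (2 / p^2) *
           ess_inf (lebesgue_on Om) (\<lambda>x. ereal
             (minimum_on {\<xi>. norm \<xi> = 1} (\<lambda>\<xi>.
                minimum_on {\<zeta>. cmod \<zeta> = 1} (\<lambda>\<zeta>. H_form (F_pow p) (A x) \<zeta> \<xi>))))
       \<and> (1 \<le> p \<longrightarrow>
           Delta (ereal p) Om A = Delta (if p = 1 then \<infinity> else ereal (p / (p - 1))) Om A)"
proof (intro conjI impI)
  \<comment> \<open>The factor 2/p^2 cancels p^2/2 pointwise in \<open>x\<close>; only afterwards is
    it pulled out of the essential infimum.\<close>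
  have "Delta (ereal p) Om A = ess_inf (lebesgue_on Om) (\<lambda>x. ereal (2 / p^2 *
      minimum_on {\<xi>. norm \<xi> = 1} (\<lambda>\<xi>.
        minimum_on {\<zeta>. cmod \<zeta> = 1} (\<lambda>\<zeta>. H_form (F_pow p) (A x) \<zeta> \<xi>))))"
    using assms(3) by (simp add: Delta_eq_twisted_form minimum_on_H_form_F_pow)
  then show "Delta (ereal p) Om A = ereal (2 / p^2) *
      ess_inf (lebesgue_on Om) (\<lambda>x. ereal (minimum_on {\<xi>. norm \<xi> = 1} (\<lambda>\<xi>.
        minimum_on {\<zeta>. cmod \<zeta> = 1} (\<lambda>\<zeta>. H_form (F_pow p) (A x) \<zeta> \<xi>))))"
    using assms(3) by (simp only: ess_inf_cmult zero_less_divide_iff zero_less_power zero_less_numeral simp_thms)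
next
  assume "1 \<le> p"
  define q where "q = (if p = 1 then \<infinity> else ereal (p / (p - 1)))"
  \<comment> \<open>Conjugate exponents satisfy 2/p + 2/q = 2; for \<open>p = 1\<close> this reads 2
    + 0 = 2, as \<open>2 / \<infinity> = 0\<close> in \<open>ereal\<close>.\<close>
  have "1 - real_of_ereal (2 / q) = - (1 - real_of_ereal (2 / ereal p))"
    using \<open>1 \<le> p\<close> by (auto simp: q_def field_simps)
  then show "Delta (ereal p) Om A = Delta (if p = 1 then \<infinity> else ereal (p / (p - 1))) Om A"
    unfolding q_def[symmetric] Delta_eq_twisted_form by (simp only: minimum_on_twisted_form_uminus)
qed

end
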